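(* Let $\mathbb{E}^3$ be $\mathbb{R}^3$ with coordinates $(x,y,z)$ and the Euclidean metric $g=dx^2+dy^2+dz^2$, endowed with the semi-symmetric metric connection $\widetilde{\nabla}$ associated with the unit vector field $U=\frac{\partial}{\partial z}$, that is, $\widetilde{\nabla}_XY=\nabla_XY+g(Y,U)X-g(X,Y)U$, where $\nabla$ is the Levi-Civita connection of $g$. Let $\gamma:I\to\mathbb{E}^3$, $\gamma(s)=(\gamma_1(s),\gamma_2(s),\gamma_3(s))$, be a semi-symmetric Frenet curve, where $s$ is the arc-length parameter. Then $\gamma$ is a semi-symmetric geodesic if and only if there exist real constants $c_1,\dots,c_6$ satisfying $$4e^{2c_1}=c_2^2+c_4^2$$ such that for all $s\in I$ $$\gamma_1(s)=e^{-c_1}c_2\arctan\left(e^{s-c_1}\right)+c_3,$$ $$\gamma_2(s)=e^{-c_1}c_4\arctan\left(e^{s-c_1}\right)+c_5,$$ $$\gamma_3(s)=-s+\ln\left(e^{2s}+e^{2c_1}\right)+c_6.$$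
   Context: Here $I\subseteq\mathbb{R}$ is an open interval. Let $(M,g)$ be a 3-dimensional Riemannian manifold with a metric connection $\widetilde{\nabla}$ of the form $\widetilde{\nabla}_XY=\nabla_XY+g(Y,U)X-g(X,Y)U$, where $\nabla$ is the Levi-Civita connection of $g$ and $U$ is a vector field on $M$, and let $\gamma:I\to M$ be a smooth unit-speed curve (with respect to $g$) with tangent $T=\gamma'$. Its semi-symmetric curvature is $\widetilde{\kappa}=\|\widetilde{\nabla}_TT\|$. The curve is a semi-symmetric geodesic (equivalently, a semi-symmetric Frenet curve of order 1) if $\widetilde{\nabla}_TT=0$ along $\gamma$. If $\widetilde{\nabla}_TT\neq 0$ along $\gamma$, its semi-symmetric normal is $N=\widetilde{\nabla}_TT/\widetilde{\kappa}$, and $\gamma$ is a semi-symmetric Frenet curve of order 2 if $\widetilde{\nabla}_TN$ is parallel to $T$ (i.e. $\widetilde{\nabla}_TN=\lambda T$ for some function $\lambda$), and of order 3 if $\widetilde{\nabla}_TN$ is not parallel to $T$. A semi-symmetric Frenet curve is one of order 1, 2 or 3; in particular it is smooth and unit-speed.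
   Formalization: The formal theorem additionally assumes that γ is not a vertical line (γ' = U on all of I, or γ' = −U on all of I); such lines are semi-symmetric geodesics but are not of the displayed form, so the claim is false for them. *)

theory Defs
  imports "HOL-Analysis.Analysis"
begin

text \<open>
  Euclidean 3-space is \<^typ>\<open>real^3\<close> with its inner product; vector fields are functions
  \<^typ>\<open>real^3 \<Rightarrow> real^3\<close>, every tangent space being identified with \<^typ>\<open>real^3\<close>. In these
  coordinates all Christoffel symbols vanish, so the Levi-Civita connection is the
  componentwise directional derivative.
\<close>

definition levi_civita :: "(real^3 \<Rightarrow> real^3) \<Rightarrow> (real^3 \<Rightarrow> real^3) \<Rightarrow> real^3 \<Rightarrow> real^3" where
  "levi_civita X Y p = frechet_derivative Y (at p) (X p)"

definition semi_symmetric ::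
    "(real^3 \<Rightarrow> real^3) \<Rightarrow> (real^3 \<Rightarrow> real^3) \<Rightarrow> (real^3 \<Rightarrow> real^3) \<Rightarrow> real^3 \<Rightarrow> real^3" where
  "semi_symmetric U X Y p =
     levi_civita X Y p + (Y p \<bullet> U p) *\<^sub>R X p - (X p \<bullet> Y p) *\<^sub>R U p"

definition tangent :: "(real \<Rightarrow> real^3) \<Rightarrow> real \<Rightarrow> real^3" where
  "tangent \<gamma> s = vector_derivative \<gamma> (at s)"

text \<open>
  The covariant derivative, along \<open>\<gamma>\<close> and in direction \<open>\<gamma>'\<close>, of a vector field \<open>V\<close> that is
  only defined along \<open>\<gamma>\<close>; the lemma below says that it is the one induced by
  \<^const>\<open>semi_symmetric\<close>.
\<close>

definition semi_symmetric_along ::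
    "(real^3 \<Rightarrow> real^3) \<Rightarrow> (real \<Rightarrow> real^3) \<Rightarrow> (real \<Rightarrow> real^3) \<Rightarrow> real \<Rightarrow> real^3" where
  "semi_symmetric_along U \<gamma> V s =
     vector_derivative V (at s)
     + (V s \<bullet> U (\<gamma> s)) *\<^sub>R tangent \<gamma> s - (tangent \<gamma> s \<bullet> V s) *\<^sub>R U (\<gamma> s)"

lemma semi_symmetric_along_restrict:
  assumes "\<gamma> differentiable (at s)" and "Y differentiable (at (\<gamma> s))"
    and "X (\<gamma> s) = tangent \<gamma> s"
  shows "semi_symmetric_along U \<gamma> (\<lambda>t. Y (\<gamma> t)) s = semi_symmetric U X Y (\<gamma> s)"
proof -
  have "(\<gamma> has_vector_derivative tangent \<gamma> s) (at s)"
    using assms(1) by (simp add: tangent_def vector_derivative_works)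
  moreover have "(Y has_derivative frechet_derivative Y (at (\<gamma> s))) (at (\<gamma> s))"
    using assms(2) by (simp add: frechet_derivative_works)
  ultimately have "((Y \<circ> \<gamma>) has_vector_derivative
      frechet_derivative Y (at (\<gamma> s)) (tangent \<gamma> s)) (at s)"
    by (intro vector_derivative_diff_chain_within)
       (auto intro: has_derivative_at_withinI)
  then have "vector_derivative (\<lambda>t. Y (\<gamma> t)) (at s)
      = frechet_derivative Y (at (\<gamma> s)) (tangent \<gamma> s)"
    by (simp add: o_def vector_derivative_at)
  then show ?thesis
    by (simp add: semi_symmetric_along_def semi_symmetric_def levi_civita_def assms(3))
qed

definition smooth_curve :: "real set \<Rightarrow> (real \<Rightarrow> real^3) \<Rightarrow> bool" where
  "smooth_curve I \<gamma> \<longleftrightarrow>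
     (\<forall>n. \<forall>s\<in>I. ((\<lambda>f t. vector_derivative f (at t)) ^^ n) \<gamma> differentiable (at s))"

definition unit_speed :: "real set \<Rightarrow> (real \<Rightarrow> real^3) \<Rightarrow> bool" where
  "unit_speed I \<gamma> \<longleftrightarrow> (\<forall>s\<in>I. norm (tangent \<gamma> s) = 1)"

definition acceleration ::
    "(real^3 \<Rightarrow> real^3) \<Rightarrow> (real \<Rightarrow> real^3) \<Rightarrow> real \<Rightarrow> real^3" where
  "acceleration U \<gamma> = semi_symmetric_along U \<gamma> (tangent \<gamma>)"

definition curvature ::
    "(real^3 \<Rightarrow> real^3) \<Rightarrow> (real \<Rightarrow> real^3) \<Rightarrow> real \<Rightarrow> real" where
  "curvature U \<gamma> s = norm (acceleration U \<gamma> s)"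

definition normal ::
    "(real^3 \<Rightarrow> real^3) \<Rightarrow> (real \<Rightarrow> real^3) \<Rightarrow> real \<Rightarrow> real^3" where
  "normal U \<gamma> s = (1 / curvature U \<gamma> s) *\<^sub>R acceleration U \<gamma> s"

definition normal_deriv_parallel ::
    "(real^3 \<Rightarrow> real^3) \<Rightarrow> real set \<Rightarrow> (real \<Rightarrow> real^3) \<Rightarrow> bool" where
  "normal_deriv_parallel U I \<gamma> \<longleftrightarrow>
     (\<exists>l. \<forall>s\<in>I. semi_symmetric_along U \<gamma> (normal U \<gamma>) s = l s *\<^sub>R tangent \<gamma> s)"

definition semi_symmetric_geodesic ::
    "(real^3 \<Rightarrow> real^3) \<Rightarrow> real set \<Rightarrow> (real \<Rightarrow> real^3) \<Rightarrow> bool" where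
  "semi_symmetric_geodesic U I \<gamma> \<longleftrightarrow> (\<forall>s\<in>I. acceleration U \<gamma> s = 0)"

definition frenet_order ::
    "nat \<Rightarrow> (real^3 \<Rightarrow> real^3) \<Rightarrow> real set \<Rightarrow> (real \<Rightarrow> real^3) \<Rightarrow> bool" where
  "frenet_order r U I \<gamma> \<longleftrightarrow>
     r = 1 \<and> semi_symmetric_geodesic U I \<gamma> \<or>
     r = 2 \<and> (\<forall>s\<in>I. acceleration U \<gamma> s \<noteq> 0) \<and> normal_deriv_parallel U I \<gamma> \<or>
     r = 3 \<and> (\<forall>s\<in>I. acceleration U \<gamma> s \<noteq> 0) \<and> \<not> normal_deriv_parallel U I \<gamma>"

definition frenet_curve ::
    "(real^3 \<Rightarrow> real^3) \<Rightarrow> real set \<Rightarrow> (real \<Rightarrow> real^3) \<Rightarrow> bool" where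
  "frenet_curve U I \<gamma> \<longleftrightarrow>
     smooth_curve I \<gamma> \<and> unit_speed I \<gamma> \<and> (\<exists>r\<in>{1, 2, 3}. frenet_order r U I \<gamma>)"

definition d_dz :: "real^3 \<Rightarrow> real^3" where
  "d_dz p = axis 3 1"

text \<open>
  The vertical lines \<open>\<gamma>' = d_dz\<close> and \<open>\<gamma>' = - d_dz\<close> are semi-symmetric geodesics for \<^const>\<open>d_dz\<close>
  (the connection terms cancel), but their third components \<open>s + c\<close> and \<open>- s + c\<close> are not of the
  form \<open>- s + ln (exp (2 * s) + exp (2 * c\<^sub>1)) + c\<^sub>6\<close> for any real \<open>c\<^sub>1\<close>: they are its limits as
  \<open>c\<^sub>1\<close> tends to minus or plus infinity. So they have to be told apart.
\<close>

definition vertical_line :: "real set \<Rightarrow> (real \<Rightarrow> real^3) \<Rightarrow> bool" where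
  "vertical_line I \<gamma> \<longleftrightarrow>
     (\<forall>s\<in>I. tangent \<gamma> s = d_dz (\<gamma> s)) \<or> (\<forall>s\<in>I. tangent \<gamma> s = - d_dz (\<gamma> s))"

end

theory Submission
  imports Defs
begin

text \<open>
  Write \<open>T = \<gamma>'\<close>. Since \<open>T\<close> has unit length, \<open>\<gamma>\<close> is a geodesic of the connection given by
  \<open>\<partial>/\<partial>z\<close> exactly when
  \<open>T\<^sub>1' = - T\<^sub>3 T\<^sub>1\<close>, \<open>T\<^sub>2' = - T\<^sub>3 T\<^sub>2\<close>, \<open>T\<^sub>3' = 1 - T\<^sub>3\<^sup>2\<close> (\<open>geodesic_iff_tangent_system\<close>).

  The substitution \<open>w = exp \<gamma>\<^sub>3\<close> linearises the Riccati equation for \<open>T\<^sub>3\<close>: from \<open>w' = T\<^sub>3 w\<close> one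
  gets \<open>w'' = (T\<^sub>3' + T\<^sub>3\<^sup>2) w = w\<close>. Hence \<open>w = A exp s + B exp (- s)\<close>, where
  \<open>2 A = (1 + T\<^sub>3) w exp (- s)\<close> and \<open>2 B = (1 - T\<^sub>3) w exp s\<close> are first integrals; so are \<open>T\<^sub>1 w\<close>
  and \<open>T\<^sub>2 w\<close> (\<open>tangent_system_first_integrals\<close>). This replaces separation of variables, and with it any case distinction on where
  \<open>\<bar>T\<^sub>3\<bar> = 1\<close>: as \<open>\<bar>T\<^sub>3\<bar> \<le> 1\<close>, both \<open>A\<close> and \<open>B\<close> are nonnegative, and \<open>B = 0\<close> or \<open>A = 0\<close> forces
  \<open>T\<^sub>3 = 1\<close> or \<open>T\<^sub>3 = -1\<close> on all of \<open>I\<close>, which makes \<open>\<gamma>\<close> a vertical line. Otherwise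
  \<open>w = A exp (- s) (exp (2 s) + B / A)\<close>; with \<open>exp (2 c\<^sub>1) = B / A\<close> the logarithm of \<open>w\<close> is the
  claimed \<open>\<gamma>\<^sub>3\<close>, integrating \<open>T\<^sub>1\<close> and \<open>T\<^sub>2\<close>, which are constant multiples of \<open>1 / w\<close>, gives the
  arctangents, and \<open>\<bar>T\<bar> = 1\<close> gives the relation between the constants
  (\<open>profile_of_tangent_system\<close>).

  Conversely, differentiating the formulas twice recovers the system for \<open>T\<close>
  (\<open>tangent_system_of_profile\<close>).
\<close>

section \<open>The geodesic equations\<close>

lemma vec3_eq_iff: "v = w \<longleftrightarrow> v $ 1 = w $ 1 \<and> v $ 2 = w $ 2 \<and> v $ 3 = w $ 3"
  for v w :: "real^3"
  by (simp add: vec_eq_iff forall_3)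

lemma d_dz_component: "d_dz p $ 1 = 0" "d_dz p $ 2 = 0" "d_dz p $ 3 = 1"
  by (simp_all add: d_dz_def axis_def)

lemma unit_vector_components:
  fixes v :: "real^3"
  assumes "norm v = 1"
  shows "(v $ 1)\<^sup>2 + (v $ 2)\<^sup>2 + (v $ 3)\<^sup>2 = 1"
  using assms unfolding norm_eq_1 by (simp add: inner_vec_def sum_3 power2_eq_square)

lemma component_has_derivative:
  fixes f :: "real \<Rightarrow> real^3"
  assumes "f differentiable (at s)"
  shows "((\<lambda>t. f t $ i) has_real_derivative vector_derivative f (at s) $ i) (at s)"
  unfolding has_real_derivative_iff_has_vector_derivative
  using assms bounded_linear.has_vector_derivative[OF bounded_linear_vec_nth]
  by (simp add: vector_derivative_works)

lemma smooth_curve_differentiable: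
  assumes "smooth_curve I \<gamma>" "s \<in> I"
  shows "\<gamma> differentiable (at s)" "tangent \<gamma> differentiable (at s)"
proof -
  have *: "((\<lambda>f t. vector_derivative f (at t)) ^^ n) \<gamma> differentiable (at s)" for n
    using assms by (simp add: smooth_curve_def)
  show "\<gamma> differentiable (at s)"
    using *[of 0] by simp
  show "tangent \<gamma> differentiable (at s)"
    using *[of 1] by (simp add: tangent_def[abs_def])
qed

lemma smooth_curve_component_derivative:
  assumes "smooth_curve I \<gamma>" "s \<in> I"
  shows "((\<lambda>t. \<gamma> t $ i) has_real_derivative tangent \<gamma> s $ i) (at s)"
  using component_has_derivative[OF smooth_curve_differentiable(1)[OF assms]]
  by (simp add: tangent_def)

definition tangent_system :: "real set \<Rightarrow> (real \<Rightarrow> real^3) \<Rightarrow> bool" where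
  "tangent_system I T \<longleftrightarrow> (\<forall>s\<in>I.
     ((\<lambda>t. T t $ 1) has_real_derivative - (T s $ 3) * T s $ 1) (at s) \<and>
     ((\<lambda>t. T t $ 2) has_real_derivative - (T s $ 3) * T s $ 2) (at s) \<and>
     ((\<lambda>t. T t $ 3) has_real_derivative 1 - (T s $ 3)\<^sup>2) (at s))"

text \<open>
  The term \<open>(T \<bullet> U) T - (T \<bullet> T) U\<close> of the connection is \<open>T\<^sub>3 T - \<partial>/\<partial>z\<close> along a unit-speed curve.
\<close>

lemma geodesic_iff_tangent_system:
  assumes "smooth_curve I \<gamma>" "unit_speed I \<gamma>"
  shows "semi_symmetric_geodesic d_dz I \<gamma> \<longleftrightarrow> tangent_system I (tangent \<gamma>)"
proof -
  have "acceleration d_dz \<gamma> s = 0 \<longleftrightarrow>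
      ((\<lambda>t. tangent \<gamma> t $ 1) has_real_derivative - (tangent \<gamma> s $ 3) * tangent \<gamma> s $ 1) (at s) \<and>
      ((\<lambda>t. tangent \<gamma> t $ 2) has_real_derivative - (tangent \<gamma> s $ 3) * tangent \<gamma> s $ 2) (at s) \<and>
      ((\<lambda>t. tangent \<gamma> t $ 3) has_real_derivative 1 - (tangent \<gamma> s $ 3)\<^sup>2) (at s)"
    if "s \<in> I" for s
  proof -
    have derivative_iff: "((\<lambda>t. tangent \<gamma> t $ i) has_real_derivative d) (at s) \<longleftrightarrow>
        vector_derivative (tangent \<gamma>) (at s) $ i = d" for i d
      using component_has_derivative[OF smooth_curve_differentiable(2)[OF assms(1) that]]
      by (metis DERIV_unique)
    have "tangent \<gamma> s \<bullet> tangent \<gamma> s = 1"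
      using assms(2) that by (simp add: unit_speed_def norm_eq_1)
    moreover have "tangent \<gamma> s \<bullet> d_dz (\<gamma> s) = tangent \<gamma> s $ 3"
      by (simp add: d_dz_def inner_axis)
    ultimately have "acceleration d_dz \<gamma> s = vector_derivative (tangent \<gamma>) (at s)
        + (tangent \<gamma> s $ 3) *\<^sub>R tangent \<gamma> s - d_dz (\<gamma> s)"
      by (simp add: acceleration_def semi_symmetric_along_def)
    then show ?thesis
      unfolding derivative_iff vec3_eq_iff
      by (simp add: d_dz_component power2_eq_square) argo
  qed
  then show ?thesis
    by (simp add: semi_symmetric_geodesic_def tangent_system_def)
qed

section \<open>Derivatives of the explicit solutions\<close>

lemma zero_derivative_constant:
  fixes f :: "real \<Rightarrow> real"
  assumes "is_interval I" "\<And>s. s \<in> I \<Longrightarrow> (f has_real_derivative 0) (at s)"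
  shows "\<exists>c. \<forall>s\<in>I. f s = c"
  using assms has_field_derivative_zero_constant[of I f]
  by (auto simp: is_interval_convex has_field_derivative_at_within)

lemma denominator_pos: "exp (2 * s) + exp (2 * c) > (0::real)"
  by (simp add: add_pos_pos)

lemma horizontal_profile_derivative:
  "((\<lambda>s. exp (- c) * a * arctan (exp (s - c)) + b) has_real_derivative
     a * exp s / (exp (2 * s) + exp (2 * c))) (at s)"
proof -
  have *: "1 + (exp (s - c))\<^sup>2 = (exp (2 * s) + exp (2 * c)) / exp (2 * c)"
    by (simp add: exp_diff exp_double power_divide add_divide_distrib)
  have "((\<lambda>s. exp (- c) * a * arctan (exp (s - c)) + b) has_real_derivative
     exp (- c) * a * (exp (s - c) / (1 + (exp (s - c))\<^sup>2))) (at s)"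
    by (auto intro!: derivative_eq_intros simp: divide_inverse)
  moreover have "exp (- c) * a * (exp (s - c) / (1 + (exp (s - c))\<^sup>2))
      = a * exp s / (exp (2 * s) + exp (2 * c))"
    unfolding * by (simp add: exp_diff exp_minus exp_double power2_eq_square divide_simps)
  ultimately show ?thesis
    by simp
qed

lemma vertical_profile_derivative:
  "((\<lambda>s. - s + ln (exp (2 * s) + exp (2 * c)) + b) has_real_derivative
     (exp (2 * s) - exp (2 * c)) / (exp (2 * s) + exp (2 * c))) (at s)"
proof -
  have *: "exp (2 * s) + exp (2 * c) \<noteq> 0"
    using denominator_pos[of s c] by simp
  show ?thesis
    by (rule derivative_eq_intros refl denominator_pos * | simp)+
       (use * in \<open>simp add: divide_simps\<close>)
qed

text \<open>
  The two velocity profiles are \<open>a / (2 exp c)\<close> times the hyperbolic secant, and the hyperbolic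
  tangent, of \<open>s - c\<close>; the next two lemmas are \<open>sech' = - tanh sech\<close> and \<open>tanh' = 1 - tanh\<^sup>2\<close>.
\<close>

lemma horizontal_velocity_derivative:
  "((\<lambda>s. a * exp s / (exp (2 * s) + exp (2 * c))) has_real_derivative
     - ((exp (2 * s) - exp (2 * c)) / (exp (2 * s) + exp (2 * c)))
       * (a * exp s / (exp (2 * s) + exp (2 * c)))) (at s)"
proof -
  have *: "exp (2 * s) + exp (2 * c) \<noteq> 0"
    using denominator_pos[of s c] by simp
  show ?thesis
    by (rule derivative_eq_intros refl denominator_pos * | simp)+
       (use * in \<open>simp add: divide_simps\<close>, simp add: algebra_simps)
qed

lemma vertical_velocity_derivative:
  "((\<lambda>s. (exp (2 * s) - exp (2 * c)) / (exp (2 * s) + exp (2 * c))) has_real_derivative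
     1 - ((exp (2 * s) - exp (2 * c)) / (exp (2 * s) + exp (2 * c)))\<^sup>2) (at s)"
proof -
  have *: "exp (2 * s) + exp (2 * c) \<noteq> 0"
    using denominator_pos[of s c] by simp
  show ?thesis
    by (rule derivative_eq_intros refl denominator_pos * | simp)+
       (use * in \<open>simp add: divide_simps power2_eq_square\<close>, simp add: algebra_simps)
qed

text \<open>
  The formulas for \<open>\<gamma>\<close> hold on \<open>I\<close> only; openness of \<open>I\<close> makes that enough to read off the
  two-sided derivatives in the definition of the tangent.
\<close>

lemma velocity_eq_profile:
  fixes p q :: "real \<Rightarrow> real"
  assumes "open I" "s \<in> I" "\<And>t. t \<in> I \<Longrightarrow> p t = q t"
    and "(p has_real_derivative v) (at s)" "(q has_real_derivative w) (at s)"
  shows "v = w"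
proof -
  have "(q has_real_derivative v) (at s)"
    using has_field_derivative_transform_within_open[OF assms(4,1,2)] assms(3) by simp
  then show ?thesis
    using assms(5) by (rule DERIV_unique)
qed

lemma tangent_system_of_profile:
  assumes "open I" "smooth_curve I \<gamma>"
    and \<gamma>1: "\<And>s. s \<in> I \<Longrightarrow> \<gamma> s $ 1 = exp (- c1) * c2 * arctan (exp (s - c1)) + c3"
    and \<gamma>2: "\<And>s. s \<in> I \<Longrightarrow> \<gamma> s $ 2 = exp (- c1) * c4 * arctan (exp (s - c1)) + c5"
    and \<gamma>3: "\<And>s. s \<in> I \<Longrightarrow> \<gamma> s $ 3 = - s + ln (exp (2 * s) + exp (2 * c1)) + c6"
  shows "tangent_system I (tangent \<gamma>)"
proof -
  let ?h = "\<lambda>a s. a * exp s / (exp (2 * s) + exp (2 * c1))"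
  let ?k = "\<lambda>s. (exp (2 * s) - exp (2 * c1)) / (exp (2 * s) + exp (2 * c1))"
  have T1: "tangent \<gamma> s $ 1 = ?h c2 s" and T2: "tangent \<gamma> s $ 2 = ?h c4 s"
    and T3: "tangent \<gamma> s $ 3 = ?k s" if "s \<in> I" for s
    using
      velocity_eq_profile[OF assms(1) that \<gamma>1
        smooth_curve_component_derivative[OF assms(2) that] horizontal_profile_derivative]
      velocity_eq_profile[OF assms(1) that \<gamma>2
        smooth_curve_component_derivative[OF assms(2) that] horizontal_profile_derivative]
      velocity_eq_profile[OF assms(1) that \<gamma>3
        smooth_curve_component_derivative[OF assms(2) that] vertical_profile_derivative]
    by blast+
  have transfer: "(p has_real_derivative d) (at s)"
    if "s \<in> I" "(q has_real_derivative d) (at s)" "\<And>t. t \<in> I \<Longrightarrow> p t = q t" for p q d s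
    using has_field_derivative_transform_within_open[OF that(2) assms(1) that(1)] that(3) by simp
  show ?thesis
    unfolding tangent_system_def
  proof (intro ballI conjI)
    fix s assume s: "s \<in> I"
    show "((\<lambda>t. tangent \<gamma> t $ 1) has_real_derivative
        - (tangent \<gamma> s $ 3) * tangent \<gamma> s $ 1) (at s)"
      unfolding T1[OF s] T3[OF s]
      by (rule transfer[OF s horizontal_velocity_derivative T1])
    show "((\<lambda>t. tangent \<gamma> t $ 2) has_real_derivative
        - (tangent \<gamma> s $ 3) * tangent \<gamma> s $ 2) (at s)"
      unfolding T2[OF s] T3[OF s]
      by (rule transfer[OF s horizontal_velocity_derivative T2])
    show "((\<lambda>t. tangent \<gamma> t $ 3) has_real_derivative 1 - (tangent \<gamma> s $ 3)\<^sup>2) (at s)"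
      unfolding T3[OF s]
      by (rule transfer[OF s vertical_velocity_derivative T3])
  qed
qed

section \<open>Integration of the geodesic equations\<close>

text \<open>
  With \<open>w = exp \<gamma>\<^sub>3\<close>, the equation \<open>w'' = w\<close> makes \<open>w' + w = (1 + T\<^sub>3) w\<close> and
  \<open>w - w' = (1 - T\<^sub>3) w\<close> solutions of \<open>u' = u\<close> and \<open>u' = - u\<close>. The last two quantities are constant
  because \<open>T\<^sub>1\<close> and \<open>T\<^sub>2\<close> satisfy the same linear equation \<open>u' = - T\<^sub>3 u\<close> as \<open>1 / w\<close>.
\<close>

lemma tangent_system_first_integrals:
  assumes "is_interval I" "smooth_curve I \<gamma>" "tangent_system I (tangent \<gamma>)"
  obtains A B D1 D2 where
    "\<And>s. s \<in> I \<Longrightarrow> (1 + tangent \<gamma> s $ 3) * exp (\<gamma> s $ 3) = 2 * A * exp s"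
    "\<And>s. s \<in> I \<Longrightarrow> (1 - tangent \<gamma> s $ 3) * exp (\<gamma> s $ 3) = 2 * B * exp (- s)"
    "\<And>s. s \<in> I \<Longrightarrow> tangent \<gamma> s $ 1 * exp (\<gamma> s $ 3) = D1"
    "\<And>s. s \<in> I \<Longrightarrow> tangent \<gamma> s $ 2 * exp (\<gamma> s $ 3) = D2"
proof -
  let ?w = "\<lambda>s. exp (\<gamma> s $ 3)"
  have w: "(?w has_real_derivative ?w s * tangent \<gamma> s $ 3) (at s)" if "s \<in> I" for s
    using DERIV_chain2[OF DERIV_exp smooth_curve_component_derivative[OF assms(2) that]] .
  have T1: "((\<lambda>t. tangent \<gamma> t $ 1) has_real_derivative
        - (tangent \<gamma> s $ 3) * tangent \<gamma> s $ 1) (at s)"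
    and T2: "((\<lambda>t. tangent \<gamma> t $ 2) has_real_derivative
        - (tangent \<gamma> s $ 3) * tangent \<gamma> s $ 2) (at s)"
    and T3: "((\<lambda>t. tangent \<gamma> t $ 3) has_real_derivative 1 - (tangent \<gamma> s $ 3)\<^sup>2) (at s)"
    if "s \<in> I" for s
    using assms(3) that by (auto simp: tangent_system_def)
  have "((\<lambda>s. (1 + tangent \<gamma> s $ 3) * ?w s * exp (- s)) has_real_derivative 0) (at s)"
    if "s \<in> I" for s
    by (rule derivative_eq_intros w[OF that] T3[OF that] refl)+
       (simp add: algebra_simps power2_eq_square)
  then obtain a where a: "\<forall>s\<in>I. (1 + tangent \<gamma> s $ 3) * ?w s * exp (- s) = a"
    using zero_derivative_constant[OF assms(1)] by blast
  have "((\<lambda>s. (1 - tangent \<gamma> s $ 3) * ?w s * exp s) has_real_derivative 0) (at s)"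
    if "s \<in> I" for s
    by (rule derivative_eq_intros w[OF that] T3[OF that] refl)+
       (simp add: algebra_simps power2_eq_square)
  then obtain b where b: "\<forall>s\<in>I. (1 - tangent \<gamma> s $ 3) * ?w s * exp s = b"
    using zero_derivative_constant[OF assms(1)] by blast
  have "((\<lambda>s. tangent \<gamma> s $ 1 * ?w s) has_real_derivative 0) (at s)" if "s \<in> I" for s
    using DERIV_mult[OF T1[OF that] w[OF that]] by (simp add: algebra_simps)
  then obtain D1 where D1: "\<forall>s\<in>I. tangent \<gamma> s $ 1 * ?w s = D1"
    using zero_derivative_constant[OF assms(1)] by blast
  have "((\<lambda>s. tangent \<gamma> s $ 2 * ?w s) has_real_derivative 0) (at s)" if "s \<in> I" for s
    using DERIV_mult[OF T2[OF that] w[OF that]] by (simp add: algebra_simps)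
  then obtain D2 where D2: "\<forall>s\<in>I. tangent \<gamma> s $ 2 * ?w s = D2"
    using zero_derivative_constant[OF assms(1)] by blast
  show thesis
  proof
    fix s assume s: "s \<in> I"
    show "(1 + tangent \<gamma> s $ 3) * exp (\<gamma> s $ 3) = 2 * (a / 2) * exp s"
      using bspec[OF a s] by (simp add: exp_minus field_simps)
    show "(1 - tangent \<gamma> s $ 3) * exp (\<gamma> s $ 3) = 2 * (b / 2) * exp (- s)"
      using bspec[OF b s] by (simp add: exp_minus field_simps)
    show "tangent \<gamma> s $ 1 * exp (\<gamma> s $ 3) = D1" "tangent \<gamma> s $ 2 * exp (\<gamma> s $ 3) = D2"
      using D1 D2 s by auto
  qed
qed

text \<open>
  A unit vector whose third component is \<open>\<plusminus>1\<close> is vertical, so on a curve that is not a vertical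
  line neither \<open>1 + T\<^sub>3\<close> nor \<open>1 - T\<^sub>3\<close> vanishes identically.
\<close>

lemma not_vertical_line_tangent:
  assumes "unit_speed I \<gamma>" "\<not> vertical_line I \<gamma>"
  obtains s t where "s \<in> I" "tangent \<gamma> s $ 3 \<noteq> 1" "t \<in> I" "tangent \<gamma> t $ 3 \<noteq> - 1"
proof -
  have *: "tangent \<gamma> s = e *\<^sub>R d_dz (\<gamma> s)"
    if "s \<in> I" "tangent \<gamma> s $ 3 = e" "e\<^sup>2 = 1" for s e
  proof -
    have "(tangent \<gamma> s $ 1)\<^sup>2 + (tangent \<gamma> s $ 2)\<^sup>2 = 0"
      using unit_vector_components[of "tangent \<gamma> s"] assms(1) that by (simp add: unit_speed_def)
    then show ?thesis
      using that by (simp add: vec3_eq_iff d_dz_component sum_power2_eq_zero_iff)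
  qed
  obtain s t where "s \<in> I" "tangent \<gamma> s \<noteq> d_dz (\<gamma> s)" "t \<in> I" "tangent \<gamma> t \<noteq> - d_dz (\<gamma> t)"
    using assms(2) unfolding vertical_line_def by blast
  with *[of s 1] *[of t "- 1"] show thesis
    by (intro that[of s t]) auto
qed

lemma profile_of_tangent_system:
  assumes "is_interval I" "smooth_curve I \<gamma>" "unit_speed I \<gamma>" "\<not> vertical_line I \<gamma>"
    and "tangent_system I (tangent \<gamma>)"
  obtains c1 c2 c3 c4 c5 c6 :: real where
    "4 * exp (2 * c1) = c2\<^sup>2 + c4\<^sup>2"
    "\<And>s. s \<in> I \<Longrightarrow> \<gamma> s $ 1 = exp (- c1) * c2 * arctan (exp (s - c1)) + c3"
    "\<And>s. s \<in> I \<Longrightarrow> \<gamma> s $ 2 = exp (- c1) * c4 * arctan (exp (s - c1)) + c5"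
    "\<And>s. s \<in> I \<Longrightarrow> \<gamma> s $ 3 = - s + ln (exp (2 * s) + exp (2 * c1)) + c6"
proof -
  obtain A B D1 D2 where
    A: "\<And>s. s \<in> I \<Longrightarrow> (1 + tangent \<gamma> s $ 3) * exp (\<gamma> s $ 3) = 2 * A * exp s" and
    B: "\<And>s. s \<in> I \<Longrightarrow> (1 - tangent \<gamma> s $ 3) * exp (\<gamma> s $ 3) = 2 * B * exp (- s)" and
    D1: "\<And>s. s \<in> I \<Longrightarrow> tangent \<gamma> s $ 1 * exp (\<gamma> s $ 3) = D1" and
    D2: "\<And>s. s \<in> I \<Longrightarrow> tangent \<gamma> s $ 2 * exp (\<gamma> s $ 3) = D2"
    using tangent_system_first_integrals[OF assms(1,2,5)] by metis
  have unit: "(tangent \<gamma> s $ 1)\<^sup>2 + (tangent \<gamma> s $ 2)\<^sup>2 + (tangent \<gamma> s $ 3)\<^sup>2 = 1"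
    if "s \<in> I" for s
    using unit_vector_components assms(3) that by (simp add: unit_speed_def)
  have T3_bound: "\<bar>tangent \<gamma> s $ 3\<bar> \<le> 1" if "s \<in> I" for s
    using component_le_norm_cart[of "tangent \<gamma> s" 3] assms(3) that by (simp add: unit_speed_def)
  obtain s t where st: "s \<in> I" "tangent \<gamma> s $ 3 \<noteq> 1" "t \<in> I" "tangent \<gamma> t $ 3 \<noteq> - 1"
    using not_vertical_line_tangent[OF assms(3,4)] by blast
  have "(1 + tangent \<gamma> t $ 3) * exp (\<gamma> t $ 3) > 0"
    using T3_bound[OF st(3)] st(4) by (intro mult_pos_pos) auto
  then have "A > 0"
    unfolding A[OF st(3)] by (simp add: zero_less_mult_iff)
  have "(1 - tangent \<gamma> s $ 3) * exp (\<gamma> s $ 3) > 0"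
    using T3_bound[OF st(1)] st(2) by (intro mult_pos_pos) auto
  then have "B > 0"
    unfolding B[OF st(1)] by (simp add: zero_less_mult_iff)
  define c where "c = ln (B / A) / 2"
  have c: "exp (2 * c) = B / A"
    using \<open>A > 0\<close> \<open>B > 0\<close> by (simp add: c_def)
  have w: "exp (\<gamma> s $ 3) = A * exp (- s) * (exp (2 * s) + exp (2 * c))" if "s \<in> I" for s
  proof -
    have "2 * exp (\<gamma> s $ 3) = 2 * A * exp s + 2 * B * exp (- s)"
      using A[OF that] B[OF that] by (simp add: algebra_simps)
    moreover have "exp (- s) * exp (2 * s) = exp s"
      by (simp flip: exp_add)
    ultimately show ?thesis
      unfolding c using \<open>A > 0\<close> by (simp add: algebra_simps)
  qed
  have T: "tangent \<gamma> s $ i = D / A * exp s / (exp (2 * s) + exp (2 * c))"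
    if "s \<in> I" "tangent \<gamma> s $ i * exp (\<gamma> s $ 3) = D" for i D s
  proof -
    have "(tangent \<gamma> s $ i * A) * (exp (2 * s) + exp (2 * c)) = D * exp s"
      using that(2) unfolding w[OF that(1)] by (simp add: exp_minus field_simps)
    then show ?thesis
      using \<open>A > 0\<close> denominator_pos[of s c] by (simp add: eq_divide_eq mult_ac)
  qed
  have horizontal: "\<exists>b. \<forall>s\<in>I. \<gamma> s $ i = exp (- c) * (D / A) * arctan (exp (s - c)) + b"
    if D: "\<And>s. s \<in> I \<Longrightarrow> tangent \<gamma> s $ i * exp (\<gamma> s $ 3) = D" for i D
  proof -
    have "((\<lambda>s. \<gamma> s $ i - (exp (- c) * (D / A) * arctan (exp (s - c)) + 0))
        has_real_derivative 0) (at s)" if s: "s \<in> I" for s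
      using DERIV_diff[OF smooth_curve_component_derivative[OF assms(2) s, of i]
          horizontal_profile_derivative[of c "D / A" 0 s]]
      unfolding T[OF s D[OF s]] by simp
    from zero_derivative_constant[OF assms(1) this] obtain b where
      "\<forall>s\<in>I. \<gamma> s $ i - (exp (- c) * (D / A) * arctan (exp (s - c)) + 0) = b"
      by auto
    then have "\<forall>s\<in>I. \<gamma> s $ i = exp (- c) * (D / A) * arctan (exp (s - c)) + b"
      by (simp add: algebra_simps)
    then show ?thesis ..
  qed
  obtain c3 where c3: "\<forall>s\<in>I. \<gamma> s $ 1 = exp (- c) * (D1 / A) * arctan (exp (s - c)) + c3"
    using horizontal[OF D1] by blast
  obtain c5 where c5: "\<forall>s\<in>I. \<gamma> s $ 2 = exp (- c) * (D2 / A) * arctan (exp (s - c)) + c5"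
    using horizontal[OF D2] by blast
  show thesis
  proof
    \<comment> \<open>Multiply \<open>1 - T\<^sub>3\<^sup>2 = T\<^sub>1\<^sup>2 + T\<^sub>2\<^sup>2\<close> by \<open>w\<^sup>2\<close>: the left side factors into the first two integrals.\<close>
    have "D1\<^sup>2 + D2\<^sup>2 = ((tangent \<gamma> s $ 1)\<^sup>2 + (tangent \<gamma> s $ 2)\<^sup>2) * (exp (\<gamma> s $ 3))\<^sup>2"
      unfolding D1[OF st(1), symmetric] D2[OF st(1), symmetric]
      by (simp add: algebra_simps power_mult_distrib)
    also have "(tangent \<gamma> s $ 1)\<^sup>2 + (tangent \<gamma> s $ 2)\<^sup>2
        = (1 + tangent \<gamma> s $ 3) * (1 - tangent \<gamma> s $ 3)"
      using unit[OF st(1)] by (simp add: algebra_simps power2_eq_square)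
    also have "\<dots> * (exp (\<gamma> s $ 3))\<^sup>2 = (2 * A * exp s) * (2 * B * exp (- s))"
      unfolding A[OF st(1), symmetric] B[OF st(1), symmetric]
      by (simp add: power2_eq_square mult_ac)
    also have "\<dots> = 4 * A * B"
      by (simp add: exp_minus)
    finally have "D1\<^sup>2 + D2\<^sup>2 = 4 * A * B" .
    then show "4 * exp (2 * c) = (D1 / A)\<^sup>2 + (D2 / A)\<^sup>2"
      using \<open>A > 0\<close>
      by (simp add: c power_divide flip: add_divide_distrib) (simp add: power2_eq_square)
    fix s assume s: "s \<in> I"
    show "\<gamma> s $ 1 = exp (- c) * (D1 / A) * arctan (exp (s - c)) + c3"
      using c3 s by blast
    show "\<gamma> s $ 2 = exp (- c) * (D2 / A) * arctan (exp (s - c)) + c5"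
      using c5 s by blast
    have "\<gamma> s $ 3 = ln (A * exp (- s) * (exp (2 * s) + exp (2 * c)))"
      by (metis ln_exp w[OF s])
    also have "\<dots> = ln A - s + ln (exp (2 * s) + exp (2 * c))"
      using \<open>A > 0\<close> denominator_pos[of s c] by (simp add: ln_mult)
    finally show "\<gamma> s $ 3 = - s + ln (exp (2 * s) + exp (2 * c)) + ln A"
      by simp
  qed
qed

theorem theorem1:
  fixes I :: "real set" and \<gamma> :: "real \<Rightarrow> real^3"
  assumes "open I" and "is_interval I" and "I \<noteq> {}"
    and "frenet_curve d_dz I \<gamma>"
    and "\<not> vertical_line I \<gamma>"
  shows "semi_symmetric_geodesic d_dz I \<gamma> \<longleftrightarrow>
    (\<exists>c1 c2 c3 c4 c5 c6 :: real.
       4 * exp (2 * c1) = c2\<^sup>2 + c4\<^sup>2 \<and>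
       (\<forall>s\<in>I.
          \<gamma> s $ 1 = exp (- c1) * c2 * arctan (exp (s - c1)) + c3 \<and>
          \<gamma> s $ 2 = exp (- c1) * c4 * arctan (exp (s - c1)) + c5 \<and>
          \<gamma> s $ 3 = - s + ln (exp (2 * s) + exp (2 * c1)) + c6))"
    (is "?L \<longleftrightarrow> ?R")
proof -
  have smooth: "smooth_curve I \<gamma>" and unit: "unit_speed I \<gamma>"
    using assms(4) by (auto simp: frenet_curve_def)
  have "tangent_system I (tangent \<gamma>) \<longleftrightarrow> ?R"
  proof
    assume "tangent_system I (tangent \<gamma>)"
    from profile_of_tangent_system[OF assms(2) smooth unit assms(5) this]
    show ?R by metis
  next
    assume ?R
    then show "tangent_system I (tangent \<gamma>)"
      using tangent_system_of_profile[OF assms(1) smooth] by blast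
  qed
  then show ?thesis
    using geodesic_iff_tangent_system[OF smooth unit] by simp
qed

end
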